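(* Let $-\infty<a<b<\infty$, and let $\gamma,p_1,p_2$ be Lebesgue measurable functions on $[a,b]$ for which there is $\varepsilon>0$ such that $0<\varepsilon<\gamma(x)<1/\varepsilon$ and $1+\varepsilon<p_i(x)<1/\varepsilon$ for almost every $x\in[a,b]$, $i=1,2$. Define the measures $$\mu_i(E)=\int_E\gamma(x)^{-1/(p_i(x)-1)}\,dx,\qquad E\subset[a,b]\text{ Lebesgue measurable},\ i=1,2 .$$ If $\Lambda_\gamma^{p_1}(m)=\Lambda_\gamma^{p_2}(m)$ for all $m>0$, then $\mu_1^{p_1}=\mu_2^{p_2}$, i.e. $$\mu_1(\{x\in[a,b]:p_1(x)>t\})=\mu_2(\{x\in[a,b]:p_2(x)>t\})\quad\text{for all }t\in[0,\infty].$$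
   Context: For a measure $\mu$ on $X$ and a measurable $f:X\to[0,\infty]$, the distribution function of $f$ is $\mu^f(t)=\mu(\{x\in X:f(x)>t\})$, $t\in[0,\infty]$. For $\gamma$ and $p$ measurable on $[a,b]$ with $\varepsilon<\gamma<1/\varepsilon$ and $1+\varepsilon<p<1/\varepsilon$ a.e. for some $\varepsilon>0$, and for $m>0$, let $K_m=K_m(\gamma,p)>0$ be the unique positive number satisfying $$m=\int_a^b \gamma(x)^{-1/(p(x)-1)}K_m^{1/(p(x)-1)}\,dx .$$ (The map $m\mapsto K_m$ is a well-defined, strictly increasing continuous bijection of $(0,\infty)$ onto itself with continuous inverse.) The Dirichlet-to-Neumann (DN) map is the function $$\Lambda_\gamma^p(m)=\int_a^b\gamma(x)^{-1/(p(x)-1)}K_m^{p(x)/(p(x)-1)}\,dx=mK_m,\qquad m>0 .$$ *)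

theory Defs
  imports "HOL-Analysis.Analysis"
begin

definition distribution_function :: "'a measure \<Rightarrow> ('a \<Rightarrow> ennreal) \<Rightarrow> ennreal \<Rightarrow> ennreal" where
  "distribution_function M f t = emeasure M {x \<in> space M. t < f x}"

definition weight_measure :: "real \<Rightarrow> real \<Rightarrow> (real \<Rightarrow> real) \<Rightarrow> (real \<Rightarrow> real) \<Rightarrow> real measure" where
  "weight_measure a b \<gamma> p =
     density (lebesgue_on {a..b}) (\<lambda>x. ennreal (\<gamma> x powr (- 1 / (p x - 1))))"

(* A non-integrable integrand has Bochner integral 0, so for m > 0 the equation below
   forces integrability. *)
definition DN_constant :: "real \<Rightarrow> real \<Rightarrow> (real \<Rightarrow> real) \<Rightarrow> (real \<Rightarrow> real) \<Rightarrow> real \<Rightarrow> real" where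
  "DN_constant a b \<gamma> p m =
     (THE K. K > 0 \<and>
        m = (LINT x|lebesgue_on {a..b}. \<gamma> x powr (- 1 / (p x - 1)) * K powr (1 / (p x - 1))))"

definition DN_map :: "real \<Rightarrow> real \<Rightarrow> (real \<Rightarrow> real) \<Rightarrow> (real \<Rightarrow> real) \<Rightarrow> real \<Rightarrow> real" where
  "DN_map a b \<gamma> p m =
     (LINT x|lebesgue_on {a..b}.
        \<gamma> x powr (- 1 / (p x - 1)) * DN_constant a b \<gamma> p m powr (p x / (p x - 1)))"

end

theory Submission
  imports Defs
begin

text \<open>
  Write \<open>w = \<gamma> powr (- 1 / (p - 1))\<close>, \<open>q = 1 / (p - 1)\<close> and \<open>F K = \<integral> w K\<^sup>q\<close>. Since \<open>q\<close> takes values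
  in a compact subinterval of \<open>(0, \<infinity>)\<close>, the map \<open>F\<close> is an increasing bijection of \<open>(0, \<infinity>)\<close>; its inverse
  is \<open>m \<mapsto> K\<^sub>m\<close>, and the DN map is \<open>m K\<^sub>m\<close> because \<open>p / (p - 1) = q + 1\<close>. Hence the DN map
  determines \<open>F\<close> (\<open>power_integrals_eq_if_DN_map_eq\<close>).

  Now \<open>F (e\<^sup>n) = \<integral> w (e\<^sup>q)\<^sup>n\<close> is the \<open>n\<close>-th moment of the image of the measure \<open>w dx\<close> under
  \<open>y = e\<^sup>q\<close>. This image is a finite measure on a compact interval, so by the Weierstrass
  approximation theorem its moments determine it (\<open>finite_measure_eqI_moments\<close>). As \<open>p = 1 + 1 / ln y\<close>
  is a Borel function of \<open>y\<close>, the image measure in turn determines the distribution function of \<open>p\<close>.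
\<close>

section \<open>Moments determine compactly supported measures\<close>

lemma finite_measure_eqI_moments:
  fixes M N :: "real measure"
  assumes "finite_measure M" "finite_measure N"
    and sets [measurable_cong]: "sets M = sets borel" "sets N = sets borel"
    and supp: "AE x in M. x \<in> {A..B}" "AE x in N. x \<in> {A..B}"
    and moments: "\<And>n::nat. (LINT x|M. x ^ n) = (LINT x|N. x ^ n)"
  shows "M = N"
proof -
  interpret M: finite_measure M by fact
  interpret N: finite_measure N by fact
  have int: "integrable M f" "integrable N f"
    if "\<And>x. x \<in> {A..B} \<Longrightarrow> \<bar>f x\<bar> \<le> D" "f \<in> borel_measurable borel" for f :: "real \<Rightarrow> real" and D
  proof -
    have "f \<in> borel_measurable M" "f \<in> borel_measurable N"
      using that(2) measurable_cong_sets[OF sets(1) refl] measurable_cong_sets[OF sets(2) refl]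
      by blast+
    moreover have "AE x in M. norm (f x) \<le> D" "AE x in N. norm (f x) \<le> D"
      by (rule eventually_mono[OF supp(1)] eventually_mono[OF supp(2)], simp add: that(1))+
    ultimately show "integrable M f" "integrable N f"
      using M.integrable_const_bound[of f D] N.integrable_const_bound[of f D] by blast+
  qed
  have int_cont: "integrable M f" "integrable N f" if "continuous_on UNIV f" for f :: "real \<Rightarrow> real"
  proof -
    have "compact (f ` {A..B})"
      using that by (intro compact_continuous_image) (auto intro: continuous_on_subset)
    then have "bounded (f ` {A..B})" by (rule compact_imp_bounded)
    then obtain D where D: "\<forall>y\<in>f ` {A..B}. norm y \<le> D"
      unfolding bounded_iff by (rule exE)
    have D': "\<bar>f x\<bar> \<le> D" if "x \<in> {A..B}" for x
      using D that by (simp only: ball_simps real_norm_def)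
    have meas: "f \<in> borel_measurable borel"
      using that by (rule borel_measurable_continuous_onI)
    show "integrable M f" by (rule int(1)[OF _ meas]) (rule D')
    show "integrable N f" by (rule int(2)[OF _ meas]) (rule D')
  qed
  have poly: "(LINT x|M. f x) = (LINT x|N. f x)" if f_poly: "real_polynomial_function f" for f
  proof -
    obtain c n where f: "f = (\<lambda>x. \<Sum>i\<le>n. c i * x ^ i)"
      using f_poly[unfolded real_polynomial_function_iff_sum] by (elim exE)
    have *: "integrable M (\<lambda>x. x ^ i)" "integrable N (\<lambda>x. x ^ i)" for i :: nat
      by (intro int_cont continuous_intros)+
    show ?thesis
      unfolding f using * by (simp add: moments)
  qed
  have cont: "(LINT x|M. f x) = (LINT x|N. f x)" if f: "continuous_on UNIV f" for f :: "real \<Rightarrow> real"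
  proof (rule ccontr)
    \<comment> \<open>the summand \<open>1\<close> makes \<open>T\<close> positive and the final estimate strict\<close>
    define T where "T = measure M (space M) + measure N (space N) + 1"
    define \<delta> where "\<delta> = \<bar>(LINT x|M. f x) - (LINT x|N. f x)\<bar> / T"
    assume "(LINT x|M. f x) \<noteq> (LINT x|N. f x)"
    moreover have T: "T > 0" unfolding T_def by (simp add: add_nonneg_pos)
    ultimately have "\<delta> > 0" by (simp add: \<delta>_def)
    have "continuous_on {A..B} f" using f by (rule continuous_on_subset) simp
    then obtain g where g: "real_polynomial_function g" "\<And>x. x \<in> {A..B} \<Longrightarrow> \<bar>f x - g x\<bar> < \<delta>"
      using Stone_Weierstrass_real_polynomial_function[of "{A..B}" f \<delta>] \<open>\<delta> > 0\<close> by auto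
    have gc: "continuous_on UNIV g"
      using g(1) continuous_on_polymonial_function by (simp add: real_polynomial_function_eq)
    have M: "\<bar>(LINT x|M. f x) - (LINT x|M. g x)\<bar> \<le> \<delta> * measure M (space M)"
    proof -
      have "\<bar>LINT x|M. f x - g x\<bar> \<le> (LINT x|M. \<bar>f x - g x\<bar>)" by (rule integral_abs_bound)
      also have "\<dots> \<le> (LINT x|M. \<delta>)"
        using supp(1) by (intro integral_mono_AE int_cont continuous_intros f gc)
          (auto intro!: less_imp_le g(2))
      finally show ?thesis
        using int_cont[OF f] int_cont[OF gc] by (simp add: mult.commute)
    qed
    have N: "\<bar>(LINT x|N. f x) - (LINT x|N. g x)\<bar> \<le> \<delta> * measure N (space N)"
    proof -
      have "\<bar>LINT x|N. f x - g x\<bar> \<le> (LINT x|N. \<bar>f x - g x\<bar>)" by (rule integral_abs_bound)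
      also have "\<dots> \<le> (LINT x|N. \<delta>)"
        using supp(2) by (intro integral_mono_AE int_cont continuous_intros f gc)
          (auto intro!: less_imp_le g(2))
      finally show ?thesis
        using int_cont[OF f] int_cont[OF gc] by (simp add: mult.commute)
    qed
    have "\<delta> * T = \<bar>(LINT x|M. f x) - (LINT x|N. f x)\<bar>" using T by (simp add: \<delta>_def)
    also have "\<dots> \<le> \<delta> * measure M (space M) + \<delta> * measure N (space N)"
      using M N poly[OF g(1)] by linarith
    also have "\<dots> < \<delta> * T" using \<open>\<delta> > 0\<close> by (simp add: T_def algebra_simps)
    finally show False by simp
  qed
  show ?thesis
  proof (rule measure_eqI_lessThan)
    show "emeasure M {x<..} = emeasure N {x<..}" for x
    proof -
      \<comment> \<open>continuous functions increasing to the indicator of the open half-line\<close>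
      define h where "h k y = min 1 (real k * max 0 (y - x))" for k and y :: real
      have hc: "continuous_on UNIV (h k)" for k
        unfolding h_def by (intro continuous_intros)
      have [measurable]: "h k \<in> borel_measurable borel" for k
        by (intro borel_measurable_continuous_onI hc)
      have lim: "(\<lambda>k. h k y) \<longlonglongrightarrow> indicator {x<..} y" for y
      proof (cases "x < y")
        case True
        obtain k0 :: nat where k0: "real k0 > 1 / (y - x)" using reals_Archimedean2 by blast
        have "eventually (\<lambda>k. h k y = 1) sequentially"
          using eventually_ge_at_top[of k0]
        proof eventually_elim
          case (elim k)
          then have "1 / (y - x) < real k" using k0 by linarith
          then have "1 < real k * (y - x)" using True by (simp add: field_simps)
          then show ?case using True by (simp add: h_def)
        qed
        then show ?thesis using True by (simp add: tendsto_eventually)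
      qed (simp add: h_def)
      have bd: "\<bar>h k y\<bar> \<le> 1" for k y by (simp add: h_def)
      have "(\<lambda>k. LINT y|M. h k y) \<longlonglongrightarrow> (LINT y|M. indicator {x<..} y)"
        by (rule integral_dominated_convergence[where w = "\<lambda>_. 1"]) (auto simp: lim bd)
      moreover have "(\<lambda>k. LINT y|N. h k y) \<longlonglongrightarrow> (LINT y|N. indicator {x<..} y)"
        by (rule integral_dominated_convergence[where w = "\<lambda>_. 1"]) (auto simp: lim bd)
      ultimately have "(LINT y|M. indicator {x<..} y) = (LINT y|N. indicator {x<..} y :: real)"
        using cont[OF hc] LIMSEQ_unique by simp
      then show ?thesis
        by (simp add: M.emeasure_eq_measure N.emeasure_eq_measure sets sets_eq_imp_space_eq[OF sets(1)]
          sets_eq_imp_space_eq[OF sets(2)])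
    qed
    show "emeasure M {x<..} < \<infinity>" for x
      using M.emeasure_finite by (metis infinity_ennreal_def top.not_eq_extremum)
  qed (fact sets)+
qed

section \<open>Integrals of powers with variable exponent\<close>

text \<open>
  A positive integrable weight \<open>w\<close> and an exponent \<open>q\<close> with values in \<open>[c, C]\<close>, where \<open>c > 0\<close>, both
  up to null sets. The underlying measure must not vanish, since otherwise \<open>F\<close> below would be zero.
\<close>
locale variable_power =
  fixes M :: "'a measure" and w q :: "'a \<Rightarrow> real" and c C :: real
  assumes w_integrable: "integrable M w"
    and w_pos: "AE x in M. w x > 0"
    and q_measurable [measurable]: "q \<in> borel_measurable M"
    and c_pos: "c > 0"
    and q_bounds: "AE x in M. c \<le> q x \<and> q x \<le> C"
    and nontrivial: "emeasure M (space M) \<noteq> 0"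
begin

text \<open>The power integral \<open>F K = \<integral> w K\<^sup>q\<close>, of interest for \<open>K > 0\<close>.\<close>
definition F :: "real \<Rightarrow> real" where
  "F K = (LINT x|M. w x * K powr q x)"

lemma w_measurable [measurable]: "w \<in> borel_measurable M"
  using w_integrable by simp

lemma powr_between:
  fixes s :: real
  assumes "s > 0" "c \<le> t" "t \<le> C"
  shows "min (s powr c) (s powr C) \<le> s powr t" "s powr t \<le> max (s powr c) (s powr C)"
proof -
  show "min (s powr c) (s powr C) \<le> s powr t"
    by (cases "s \<ge> 1") (use assms powr_mono[of _ _ s] powr_mono'[of _ _ s] in \<open>auto simp: min_le_iff_disj\<close>)
  show "s powr t \<le> max (s powr c) (s powr C)"
    by (cases "s \<ge> 1") (use assms powr_mono[of _ _ s] powr_mono'[of _ _ s] in \<open>auto simp: le_max_iff_disj\<close>)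
qed

lemma integrable_power:
  assumes "K > 0"
  shows "integrable M (\<lambda>x. w x * K powr q x)"
proof (rule Bochner_Integration.integrable_bound)
  show "integrable M (\<lambda>x. w x * max (K powr c) (K powr C))"
    using w_integrable by simp
  show "AE x in M. norm (w x * K powr q x) \<le> norm (w x * max (K powr c) (K powr C))"
    using w_pos q_bounds
  proof eventually_elim
    case (elim x)
    then show ?case using powr_between[OF assms, of "q x"]
      by (auto simp: abs_mult intro!: mult_left_mono)
  qed
qed measurable

lemma F_pos:
  assumes "K > 0" shows "F K > 0"
proof -
  have nn: "AE x in M. 0 \<le> w x * K powr q x" using w_pos by eventually_elim simp
  have "F K \<noteq> 0"
  proof
    assume "F K = 0"
    then have "AE x in M. w x * K powr q x = 0"
      using integral_nonneg_eq_0_iff_AE[OF integrable_power[OF assms] nn] by (simp add: F_def)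
    with w_pos have "AE x in M. False"
      by eventually_elim (use assms in simp)
    then show False using nontrivial by (simp add: AE_iff_null null_sets_def)
  qed
  moreover have "F K \<ge> 0" unfolding F_def using nn by (rule integral_nonneg_AE)
  ultimately show ?thesis by simp
qed

text \<open>
  Together with positivity, this two-sided comparison under scaling of the argument yields strict
  monotonicity, continuity and surjectivity of \<open>F\<close>.
\<close>
lemma F_scale:
  assumes "K > 0" "s > 0"
  shows "min (s powr c) (s powr C) * F K \<le> F (s * K)"
    and "F (s * K) \<le> max (s powr c) (s powr C) * F K"
proof -
  have sK: "s * K > 0" using assms by simp
  have *: "AE x in M. min (s powr c) (s powr C) * (w x * K powr q x) \<le> w x * (s * K) powr q x
      \<and> w x * (s * K) powr q x \<le> max (s powr c) (s powr C) * (w x * K powr q x)"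
    using w_pos q_bounds
  proof eventually_elim
    case (elim x)
    have "w x * (s * K) powr q x = s powr q x * (w x * K powr q x)"
      using assms by (simp add: powr_mult)
    then show ?case
      using powr_between[OF assms(2), of "q x"] elim by (auto intro!: mult_right_mono)
  qed
  have "(LINT x|M. min (s powr c) (s powr C) * (w x * K powr q x)) \<le> F (s * K)"
    unfolding F_def using * by (intro integral_mono_AE integrable_power sK integrable_mult_right assms) auto
  then show "min (s powr c) (s powr C) * F K \<le> F (s * K)" by (simp add: F_def)
  have "F (s * K) \<le> (LINT x|M. max (s powr c) (s powr C) * (w x * K powr q x))"
    unfolding F_def using * by (intro integral_mono_AE integrable_power sK integrable_mult_right assms) auto
  then show "F (s * K) \<le> max (s powr c) (s powr C) * F K" by (simp add: F_def)
qed

lemma c_le_C: "c \<le> C"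
proof (rule ccontr)
  assume "\<not> c \<le> C"
  from q_bounds have "AE x in M. False"
    by eventually_elim (use \<open>\<not> c \<le> C\<close> in linarith)
  then show False using nontrivial by (simp add: AE_iff_null null_sets_def)
qed

lemma F_strict_mono:
  assumes "0 < K" "K < L" shows "F K < F L"
proof -
  have s: "1 < L / K" using assms by simp
  then have "1 < min ((L / K) powr c) ((L / K) powr C)"
    using c_pos c_le_C by simp
  then have "F K < min ((L / K) powr c) ((L / K) powr C) * F K"
    using F_pos[OF assms(1)] mult_strict_right_mono by force
  also have "\<dots> \<le> F (L / K * K)" using assms s by (intro F_scale) auto
  finally show ?thesis using assms by simp
qed

lemma F_inj: "0 < K \<Longrightarrow> 0 < L \<Longrightarrow> F K = F L \<Longrightarrow> K = L"
  using F_strict_mono by (metis less_irrefl linorder_neqE)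

lemma F_continuous: "continuous_on {0<..} F"
proof (rule continuous_at_imp_continuous_on, rule ballI)
  fix K :: real assume "K \<in> {0<..}"
  then have K: "K > 0" by simp
  have ev: "eventually (\<lambda>L. L > 0) (at K)"
    using eventually_at_topological open_greaterThan[of 0] K by (metis greaterThan_iff)
  have eq: "F (L / K * K) = F L" for L using K by simp
  have lo: "((\<lambda>L. min ((L / K) powr c) ((L / K) powr C) * F K) \<longlongrightarrow> min ((K / K) powr c) ((K / K) powr C) * F K) (at K)"
    using K by (intro tendsto_intros) auto
  have hi: "((\<lambda>L. max ((L / K) powr c) ((L / K) powr C) * F K) \<longlongrightarrow> max ((K / K) powr c) ((K / K) powr C) * F K) (at K)"
    using K by (intro tendsto_intros) auto
  have "(F \<longlongrightarrow> F K) (at K)"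
  proof (rule tendsto_sandwich)
    show "eventually (\<lambda>L. min ((L / K) powr c) ((L / K) powr C) * F K \<le> F L) (at K)"
      using ev by eventually_elim (metis F_scale(1) K divide_pos_pos eq)
    show "eventually (\<lambda>L. F L \<le> max ((L / K) powr c) ((L / K) powr C) * F K) (at K)"
      using ev by eventually_elim (metis F_scale(2) K divide_pos_pos eq)
  qed (use lo hi K in simp_all)
  then show "isCont F K" by (simp add: isCont_def)
qed

lemma F_surj:
  assumes "m > 0"
  obtains K where "K > 0" "F K = m"
proof -
  \<comment> \<open>chosen so that the exponent \<open>c\<close> in the scaling bounds turns \<open>F 1\<close> into \<open>m\<close>\<close>
  define s where "s = (m / F 1) powr (1 / c)"
  have F1: "F 1 > 0" by (simp add: F_pos)
  have s: "s > 0" using assms F1 by (simp add: s_def)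
  have sc: "s powr c * F 1 = m" using assms F1 c_pos by (simp add: s_def powr_powr)
  have cont: "continuous_on {u..v} F" if "u > 0" for u v
    using F_continuous by (rule continuous_on_subset) (use that in auto)
  have "\<exists>K>0. F K = m"
  proof (cases "s \<ge> 1")
    case True
    then have p: "s powr c \<le> s powr C" "1 \<le> s powr c"
      using c_le_C c_pos by (auto intro: powr_mono ge_one_powr_ge_zero)
    have "m \<le> F s" using F_scale(1)[of 1 s] s sc p by (simp add: min_def)
    moreover have "F 1 \<le> m" using sc p F1 mult_right_mono[of 1 "s powr c" "F 1"] by simp
    ultimately obtain K where "1 \<le> K" "F K = m"
      using IVT'[of F 1 m s] True cont by auto
    then show ?thesis by (intro exI[of _ K]) auto
  next
    case False
    then have p: "s powr C \<le> s powr c" "s powr c \<le> 1"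
      using c_le_C c_pos s by (auto intro: powr_mono' powr_le1)
    have "F s \<le> m" using F_scale(2)[of 1 s] s sc p by (simp add: max_def split: if_splits)
    moreover have "m \<le> F 1" using sc p F1 mult_right_mono[of "s powr c" 1 "F 1"] by simp
    ultimately obtain K where "s \<le> K" "F K = m"
      using IVT'[of F s m 1] False cont[OF s] by auto
    then show ?thesis using s by (intro exI[of _ K]) auto
  qed
  then show ?thesis using that by blast
qed

end

section \<open>The Dirichlet-to-Neumann map\<close>

lemma variable_power_conductivity:
  fixes a b \<epsilon> :: real and \<gamma> p :: "real \<Rightarrow> real"
  assumes "a < b"
    and [measurable]: "\<gamma> \<in> borel_measurable (lebesgue_on {a..b})" "p \<in> borel_measurable (lebesgue_on {a..b})"
    and "\<epsilon> > 0"
    and bounds: "AE x in lebesgue_on {a..b}.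
      \<epsilon> < \<gamma> x \<and> \<gamma> x < 1 / \<epsilon> \<and> 1 + \<epsilon> < p x \<and> p x < 1 / \<epsilon>"
  shows "variable_power (lebesgue_on {a..b}) (\<lambda>x. \<gamma> x powr (- 1 / (p x - 1)))
           (\<lambda>x. 1 / (p x - 1)) \<epsilon> (1 / \<epsilon>)"
proof
  let ?M = "lebesgue_on {a..b}"
  interpret finite_measure ?M
    by (rule finite_measure_lebesgue_on) (simp add: lmeasurable_interval)
  show q: "AE x in ?M. \<epsilon> \<le> 1 / (p x - 1) \<and> 1 / (p x - 1) \<le> 1 / \<epsilon>"
    using bounds
  proof eventually_elim
    case (elim x)
    have "\<epsilon> * (p x - 1) \<le> 1"
      using elim \<open>\<epsilon> > 0\<close> by (simp add: field_simps)
    then show ?case using elim \<open>\<epsilon> > 0\<close> by (simp add: field_simps)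
  qed
  show "AE x in ?M. 0 < \<gamma> x powr (- 1 / (p x - 1))"
    using bounds by eventually_elim (use \<open>\<epsilon> > 0\<close> in auto)
  show "integrable ?M (\<lambda>x. \<gamma> x powr (- 1 / (p x - 1)))"
  proof (rule integrable_const_bound[where B = "(1 / \<epsilon>) powr (1 / \<epsilon>)"])
    show "AE x in ?M. norm (\<gamma> x powr (- 1 / (p x - 1))) \<le> (1 / \<epsilon>) powr (1 / \<epsilon>)"
      using bounds q
    proof eventually_elim
      case (elim x)
      let ?q = "1 / (p x - 1)"
      have "\<epsilon> < 1 / \<epsilon>" using elim by linarith
      then have "1 \<le> 1 / \<epsilon>"
        using \<open>\<epsilon> > 0\<close> by (smt (verit) le_divide_eq_1_pos)
      have "\<gamma> x powr (- 1 / (p x - 1)) = (1 / \<gamma> x) powr ?q"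
        using elim \<open>\<epsilon> > 0\<close> by (simp add: powr_minus powr_divide inverse_eq_divide flip: minus_divide_left)
      also have "\<dots> \<le> (1 / \<epsilon>) powr ?q"
        using elim \<open>\<epsilon> > 0\<close> by (intro powr_mono2) (auto simp: frac_le)
      also have "\<dots> \<le> (1 / \<epsilon>) powr (1 / \<epsilon>)"
        using \<open>1 \<le> 1 / \<epsilon>\<close> elim by (intro powr_mono) auto
      finally show ?case by simp
    qed
  qed measurable
  show "emeasure ?M (space ?M) \<noteq> 0"
    using \<open>a < b\<close> by (simp add: emeasure_restrict_space)
qed (use \<open>\<epsilon> > 0\<close> in measurable)

text \<open>
  The definite description \<open>K\<^sub>m\<close> denotes the unique positive solution of its defining equation,
  and the DN map takes the value \<open>m K\<^sub>m\<close>.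
\<close>
lemma DN_constant_works:
  fixes a b c C m :: real and \<gamma> p :: "real \<Rightarrow> real"
  assumes vp: "variable_power (lebesgue_on {a..b}) (\<lambda>x. \<gamma> x powr (- 1 / (p x - 1)))
           (\<lambda>x. 1 / (p x - 1)) c C"
    and "m > 0"
  defines "K \<equiv> DN_constant a b \<gamma> p m"
  shows "K > 0"
    and "(LINT x|lebesgue_on {a..b}. \<gamma> x powr (- 1 / (p x - 1)) * K powr (1 / (p x - 1))) = m"
    and "DN_map a b \<gamma> p m = m * K"
proof -
  interpret variable_power "lebesgue_on {a..b}" "\<lambda>x. \<gamma> x powr (- 1 / (p x - 1))"
    "\<lambda>x. 1 / (p x - 1)" c C by (rule vp)
  obtain L where "L > 0" "F L = m" using F_surj[OF \<open>m > 0\<close>] .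
  then have "\<exists>!K. K > 0 \<and> m = F K" using F_inj by blast
  then have "K > 0 \<and> m = F K"
    unfolding K_def DN_constant_def F_def by (rule theI')
  then show K: "K > 0"
    and m: "(LINT x|lebesgue_on {a..b}. \<gamma> x powr (- 1 / (p x - 1)) * K powr (1 / (p x - 1))) = m"
    unfolding F_def by auto
  have "DN_map a b \<gamma> p m =
      (LINT x|lebesgue_on {a..b}. \<gamma> x powr (- 1 / (p x - 1)) * K powr (1 / (p x - 1)) * K)"
    unfolding DN_map_def K_def[symmetric]
  proof (rule integral_cong_AE)
    show "AE x in lebesgue_on {a..b}. \<gamma> x powr (- 1 / (p x - 1)) * K powr (p x / (p x - 1))
        = \<gamma> x powr (- 1 / (p x - 1)) * K powr (1 / (p x - 1)) * K"
      using q_bounds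
    proof eventually_elim
      case (elim x)
      then have "p x / (p x - 1) = 1 / (p x - 1) + 1"
        using c_pos by (cases "p x = 1") (auto simp: field_simps)
      then show ?case using K by (simp add: powr_add)
    qed
    \<comment> \<open>measurability of \<open>p\<close> from that of the exponent; the identity also holds where \<open>p x = 1\<close>\<close>
    have "(\<lambda>x. 1 + 1 / (1 / (p x - 1))) \<in> borel_measurable (lebesgue_on {a..b})"
      by measurable
    then have [measurable]: "p \<in> borel_measurable (lebesgue_on {a..b})"
      by simp
    show "(\<lambda>x. \<gamma> x powr (- 1 / (p x - 1)) * K powr (p x / (p x - 1))) \<in> borel_measurable (lebesgue_on {a..b})"
      by measurable
  qed measurable
  also have "\<dots> = m * K" using m by simp
  finally show "DN_map a b \<gamma> p m = m * K" .
qed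

lemma power_integrals_eq_if_DN_map_eq:
  assumes vp1: "variable_power (lebesgue_on {a..b}) (\<lambda>x. \<gamma> x powr (- 1 / (p1 x - 1)))
           (\<lambda>x. 1 / (p1 x - 1)) c C"
    and vp2: "variable_power (lebesgue_on {a..b}) (\<lambda>x. \<gamma> x powr (- 1 / (p2 x - 1)))
           (\<lambda>x. 1 / (p2 x - 1)) c C"
    and DN: "\<forall>m>0. DN_map a b \<gamma> p1 m = DN_map a b \<gamma> p2 m"
    and "K > 0"
  shows "(LINT x|lebesgue_on {a..b}. \<gamma> x powr (- 1 / (p1 x - 1)) * K powr (1 / (p1 x - 1))) =
         (LINT x|lebesgue_on {a..b}. \<gamma> x powr (- 1 / (p2 x - 1)) * K powr (1 / (p2 x - 1)))"
proof -
  interpret V1: variable_power "lebesgue_on {a..b}" "\<lambda>x. \<gamma> x powr (- 1 / (p1 x - 1))"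
    "\<lambda>x. 1 / (p1 x - 1)" c C by (rule vp1)
  define m where "m = V1.F K"
  have m: "m > 0" unfolding m_def by (rule V1.F_pos[OF \<open>K > 0\<close>])
  note 1 = DN_constant_works[OF vp1 m] and 2 = DN_constant_works[OF vp2 m]
  have "V1.F (DN_constant a b \<gamma> p1 m) = V1.F K"
    unfolding m_def[symmetric] unfolding V1.F_def by (rule 1(2))
  then have "DN_constant a b \<gamma> p1 m = K"
    using 1(1) \<open>K > 0\<close> V1.F_inj by blast
  moreover have "DN_constant a b \<gamma> p2 m = DN_constant a b \<gamma> p1 m"
  proof -
    have "m * DN_constant a b \<gamma> p2 m = m * DN_constant a b \<gamma> p1 m"
      unfolding 1(3)[symmetric] 2(3)[symmetric] using DN m by (simp only:)
    then show ?thesis using m by (simp only: mult_cancel_left) auto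
  qed
  ultimately have "DN_constant a b \<gamma> p1 m = K" "DN_constant a b \<gamma> p2 m = K" by (simp_all only:)
  with 1(2) 2(2) show ?thesis by (simp only:)
qed

text \<open>
  The law of \<open>y = exp (1 / (p - 1))\<close> under the weight measure. Its moments are the values of the
  power integral at \<open>K = e\<^sup>n\<close>, and \<open>p = 1 + 1 / ln y\<close> can be recovered from \<open>y\<close>.
\<close>
definition exponent_law :: "real \<Rightarrow> real \<Rightarrow> (real \<Rightarrow> real) \<Rightarrow> (real \<Rightarrow> real) \<Rightarrow> real measure" where
  "exponent_law a b \<gamma> p = distr (weight_measure a b \<gamma> p) borel (\<lambda>x. exp (1 / (p x - 1)))"

lemma exponent_law_properties:
  assumes vp: "variable_power (lebesgue_on {a..b}) (\<lambda>x. \<gamma> x powr (- 1 / (p x - 1)))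
           (\<lambda>x. 1 / (p x - 1)) c C"
  shows finite_measure_exponent_law: "finite_measure (exponent_law a b \<gamma> p)"
    and AE_exponent_law: "AE y in exponent_law a b \<gamma> p. y \<in> {exp c..exp C}"
    and moment_exponent_law: "(LINT y|exponent_law a b \<gamma> p. y ^ n) =
      (LINT x|lebesgue_on {a..b}. \<gamma> x powr (- 1 / (p x - 1)) * exp (real n) powr (1 / (p x - 1)))"
    and distribution_function_exponent_law:
      "distribution_function (weight_measure a b \<gamma> p) (\<lambda>x. ennreal (p x)) t =
       emeasure (exponent_law a b \<gamma> p) {y. t < ennreal (1 + 1 / ln y)}"
proof -
  let ?M = "lebesgue_on {a..b}" and ?w = "\<lambda>x. \<gamma> x powr (- 1 / (p x - 1))"
  interpret variable_power ?M ?w "\<lambda>x. 1 / (p x - 1)" c C by (rule vp)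
  \<comment> \<open>measurability of \<open>p\<close> from that of the exponent; the identity also holds where \<open>p x = 1\<close>\<close>
  have "(\<lambda>x. 1 + 1 / (1 / (p x - 1))) \<in> borel_measurable ?M"
    by measurable
  then have [measurable]: "p \<in> borel_measurable ?M" by simp
  have [measurable]: "(\<lambda>x. \<gamma> x powr - (1 / (p x - 1))) \<in> borel_measurable ?M"
    using w_measurable by simp
  let ?W = "weight_measure a b \<gamma> p"
  have [measurable_cong]: "sets ?W = sets ?M" by (simp add: weight_measure_def)
  have space: "space ?W = {a..b}" by (simp add: weight_measure_def)
  have fin: "finite_measure ?W"
  proof
    have "emeasure ?W (space ?W) = (\<integral>\<^sup>+x. ennreal (?w x) \<partial>?M)"
      unfolding weight_measure_def by (subst emeasure_density) (auto intro!: nn_integral_cong)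
    also have "\<dots> < \<infinity>"
      using w_integrable by (simp add: nn_integral_eq_integral)
    finally show "emeasure ?W (space ?W) \<noteq> \<infinity>" by simp
  qed
  then show "finite_measure (exponent_law a b \<gamma> p)"
    unfolding exponent_law_def by (rule finite_measure.finite_measure_distr) measurable
  have W_bounds: "AE x in ?W. c \<le> 1 / (p x - 1) \<and> 1 / (p x - 1) \<le> C"
    unfolding weight_measure_def using q_bounds by (subst AE_density) auto
  then show "AE y in exponent_law a b \<gamma> p. y \<in> {exp c..exp C}"
    unfolding exponent_law_def by (subst AE_distr_iff) auto
  have "(LINT y|exponent_law a b \<gamma> p. y ^ n) = (LINT x|?W. exp (1 / (p x - 1)) ^ n)"
    unfolding exponent_law_def by (rule integral_distr) measurable
  also have "\<dots> = (LINT x|?M. ?w x * exp (1 / (p x - 1)) ^ n)"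
    unfolding weight_measure_def by (subst integral_density) auto
  also have "\<dots> = (LINT x|?M. ?w x * exp (real n) powr (1 / (p x - 1)))"
    by (simp add: powr_def flip: exp_of_nat_mult)
  finally show "(LINT y|exponent_law a b \<gamma> p. y ^ n) =
      (LINT x|?M. ?w x * exp (real n) powr (1 / (p x - 1)))" .
  have "emeasure (exponent_law a b \<gamma> p) {y. t < ennreal (1 + 1 / ln y)} =
      emeasure ?W {x \<in> space ?W. t < ennreal (1 + 1 / ln (exp (1 / (p x - 1))))}"
    unfolding exponent_law_def
    by (subst emeasure_distr) (auto intro!: arg_cong[where f = "emeasure ?W"])
  \<comment> \<open>\<open>p = 1 + 1 / ln y\<close> holds at every point, even where \<open>p x = 1\<close>, because \<open>1 / 0 = 0\<close>\<close>
  then show "distribution_function ?W (\<lambda>x. ennreal (p x)) t =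
      emeasure (exponent_law a b \<gamma> p) {y. t < ennreal (1 + 1 / ln y)}"
    by (simp add: distribution_function_def)
qed

section \<open>Determination of the distribution function\<close>

theorem theorem12:
  fixes a b :: real and \<gamma> p1 p2 :: "real \<Rightarrow> real"
  assumes "a < b"
    and "\<gamma> \<in> borel_measurable (lebesgue_on {a..b})"
    and "p1 \<in> borel_measurable (lebesgue_on {a..b})"
    and "p2 \<in> borel_measurable (lebesgue_on {a..b})"
    and "\<exists>\<epsilon>>0. AE x in lebesgue_on {a..b}.
           \<epsilon> < \<gamma> x \<and> \<gamma> x < 1 / \<epsilon> \<and>
           1 + \<epsilon> < p1 x \<and> p1 x < 1 / \<epsilon> \<and>
           1 + \<epsilon> < p2 x \<and> p2 x < 1 / \<epsilon>"
    and "\<forall>m>0. DN_map a b \<gamma> p1 m = DN_map a b \<gamma> p2 m"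
  shows "\<forall>t. distribution_function (weight_measure a b \<gamma> p1) (\<lambda>x. ennreal (p1 x)) t =
             distribution_function (weight_measure a b \<gamma> p2) (\<lambda>x. ennreal (p2 x)) t"
proof -
  obtain \<epsilon> where "\<epsilon> > 0" and \<epsilon>: "AE x in lebesgue_on {a..b}.
           \<epsilon> < \<gamma> x \<and> \<gamma> x < 1 / \<epsilon> \<and>
           1 + \<epsilon> < p1 x \<and> p1 x < 1 / \<epsilon> \<and>
           1 + \<epsilon> < p2 x \<and> p2 x < 1 / \<epsilon>"
    using assms(5) by blast
  have vp1: "variable_power (lebesgue_on {a..b}) (\<lambda>x. \<gamma> x powr (- 1 / (p1 x - 1)))
           (\<lambda>x. 1 / (p1 x - 1)) \<epsilon> (1 / \<epsilon>)"
    using assms(1-4) \<open>\<epsilon> > 0\<close> \<epsilon> by (intro variable_power_conductivity) auto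
  have vp2: "variable_power (lebesgue_on {a..b}) (\<lambda>x. \<gamma> x powr (- 1 / (p2 x - 1)))
           (\<lambda>x. 1 / (p2 x - 1)) \<epsilon> (1 / \<epsilon>)"
    using assms(1-4) \<open>\<epsilon> > 0\<close> \<epsilon> by (intro variable_power_conductivity) auto
  have "exponent_law a b \<gamma> p1 = exponent_law a b \<gamma> p2"
  proof (rule finite_measure_eqI_moments)
    show "finite_measure (exponent_law a b \<gamma> p1)" "finite_measure (exponent_law a b \<gamma> p2)"
      by (rule finite_measure_exponent_law vp1 vp2)+
    show "AE y in exponent_law a b \<gamma> p1. y \<in> {exp \<epsilon>..exp (1 / \<epsilon>)}"
      "AE y in exponent_law a b \<gamma> p2. y \<in> {exp \<epsilon>..exp (1 / \<epsilon>)}"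
      by (rule AE_exponent_law vp1 vp2)+
    show "(LINT y|exponent_law a b \<gamma> p1. y ^ n) = (LINT y|exponent_law a b \<gamma> p2. y ^ n)" for n
      unfolding moment_exponent_law[OF vp1] moment_exponent_law[OF vp2]
      by (rule power_integrals_eq_if_DN_map_eq[OF vp1 vp2 assms(6)]) simp
  qed (simp_all add: exponent_law_def)
  then show ?thesis
    by (simp add: distribution_function_exponent_law[OF vp1] distribution_function_exponent_law[OF vp2])
qed

end
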